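(* Let $p,q\in\mathbb{N}$ and $\mathbb{X}\subseteq\mathbb{R}^p$. If $\boldsymbol{m}_{[1]},\boldsymbol{m}_{[2]}\in\mathcal{M}_q^{*}(\mathbb{X})$, then $\boldsymbol{m}_{[12]}\in\mathcal{M}_q^{*}(\mathbb{X})$, where $\boldsymbol{m}_{[12]}=\boldsymbol{m}_{[1]}+\boldsymbol{m}_{[2]}$.
   Context: For $\boldsymbol{\mu}\in\mathbb{R}^p$ and symmetric positive-definite $\boldsymbol{\Sigma}\in\mathbb{R}^{p\times p}$, $\phi_p(\boldsymbol{x};\boldsymbol{\mu},\boldsymbol{\Sigma})=|2\pi\boldsymbol{\Sigma}|^{-1/2}\exp[-\tfrac12(\boldsymbol{x}-\boldsymbol{\mu})^\top\boldsymbol{\Sigma}^{-1}(\boldsymbol{x}-\boldsymbol{\mu})]$ is the Gaussian density. $\mathcal{M}_q^{*}(\mathbb{X})$ is the class of all functions $\boldsymbol{m}:\mathbb{X}\to\mathbb{R}^q$ of the form \[ \boldsymbol{m}(\boldsymbol{x})=\sum_{z=1}^n\frac{\pi_z\,\phi_p(\boldsymbol{x};\boldsymbol{\mu}_z,\boldsymbol{\Sigma}_z)}{\sum_{\zeta=1}^n\pi_\zeta\,\phi_p(\boldsymbol{x};\boldsymbol{\mu}_\zeta,\boldsymbol{\Sigma}_\zeta)}\,\boldsymbol{a}_z, \] where $n\in\mathbb{N}$ (positive integers; $n$ may vary with $\boldsymbol{m}$), $\pi_z>0$ with $\sum_{z=1}^n\pi_z=1$, $\boldsymbol{\mu}_z\in\mathbb{R}^p$,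 $\boldsymbol{\Sigma}_z\in\mathbb{R}^{p\times p}$ symmetric positive-definite, and $\boldsymbol{a}_z\in\mathbb{R}^q$, for $z\in\{1,\dots,n\}$. *)

theory Defs
  imports "HOL-Analysis.Analysis"
begin

definition symmetric_posdef :: "real ^ 'p ^ 'p \<Rightarrow> bool" where
  "symmetric_posdef S \<longleftrightarrow> transpose S = S \<and> (\<forall>v. v \<noteq> 0 \<longrightarrow> 0 < v \<bullet> (S *v v))"

definition gaussian_density :: "real ^ 'p \<Rightarrow> real ^ 'p ^ 'p \<Rightarrow> real ^ 'p \<Rightarrow> real" where
  "gaussian_density \<mu> S x =
     det ((2 * pi) *\<^sub>R S) powr (- 1 / 2) *
     exp (- (1 / 2) * ((x - \<mu>) \<bullet> (matrix_inv S *v (x - \<mu>))))"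

(* A function from X to R^q is represented by a total function of which only the values
   on X matter: the defining formula is required at the points of X and nowhere else. *)
definition gaussian_gated_class :: "(real ^ 'p) set \<Rightarrow> (real ^ 'p \<Rightarrow> real ^ 'q) set" where
  "gaussian_gated_class X =
     {m. \<exists>(n::nat) (\<pi> :: nat \<Rightarrow> real) (\<mu> :: nat \<Rightarrow> real ^ 'p)
           (S :: nat \<Rightarrow> real ^ 'p ^ 'p) (a :: nat \<Rightarrow> real ^ 'q).
         1 \<le> n \<and>
         (\<forall>z\<in>{1..n}. 0 < \<pi> z) \<and>
         (\<Sum>z=1..n. \<pi> z) = 1 \<and>
         (\<forall>z\<in>{1..n}. symmetric_posdef (S z)) \<and>
         (\<forall>x\<in>X. m x =
            (\<Sum>z=1..n.
               (\<pi> z * gaussian_density (\<mu> z) (S z) x /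
                (\<Sum>\<zeta>=1..n. \<pi> \<zeta> * gaussian_density (\<mu> \<zeta>) (S \<zeta>) x)) *\<^sub>R a z))}"

end

theory Submission
  imports Defs
begin

text \<open>The product of two Gaussian densities is, up to a positive constant, a Gaussian density:
  completing the square adds the precision matrices.  Hence, writing the sum of two gated averages
  as a single gated average over pairs \<open>(i, j)\<close> with gates \<open>g\<^sub>i h\<^sub>j / (\<Sum>g)(\<Sum>h)\<close> and
  values \<open>a\<^sub>i + b\<^sub>j\<close>, each product gate is again Gaussian, and a common
  rescaling of the weights, which the gates do not see, makes them sum to one.\<close>

section \<open>Inverses and positive definite matrices\<close>

lemma invertible_matrix_inv:
  assumes "invertible A"
  shows "A ** matrix_inv A = mat 1" "matrix_inv A ** A = mat 1"
  using assms someI_ex[of "\<lambda>B. A ** B = mat 1 \<and> B ** A = mat 1"]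
  unfolding invertible_def matrix_inv_def by auto

lemma matrix_inv_unique:
  assumes "A ** B = mat 1" "B ** A = mat 1"
  shows "matrix_inv A = B"
proof -
  have "invertible A"
    using assms unfolding invertible_def by blast
  then show ?thesis
    by (metis assms(2) invertible_matrix_inv(1) matrix_mul_assoc matrix_mul_lid matrix_mul_rid)
qed

text \<open>A nonzero kernel vector would make the quadratic form vanish; for a square matrix a
  trivial kernel is enough.\<close>

lemma symmetric_posdef_invertible:
  fixes S :: "real ^ 'p ^ 'p"
  assumes "symmetric_posdef S"
  shows "invertible S"
proof -
  have "v = 0" if "S *v v = 0" for v
    using assms that unfolding symmetric_posdef_def by (metis inner_zero_right less_irrefl)
  then show ?thesis
    by (metis invertible_left_inverse matrix_left_invertible_ker)
qed

lemma symmetric_posdef_inner_commute: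
  assumes "symmetric_posdef S"
  shows "x \<bullet> (S *v y) = y \<bullet> (S *v x)"
  using assms unfolding symmetric_posdef_def
  by (metis dot_lmul_matrix inner_commute transpose_matrix_vector)

text \<open>Substitute \<open>v = S *v w\<close> with \<open>w = matrix_inv S *v v\<close>: the form
  of the inverse at \<open>v\<close> is the form of \<open>S\<close> at \<open>w\<close>. Symmetry
  holds because the transposed inverse is again a left inverse of \<open>S\<close>.\<close>

lemma symmetric_posdef_matrix_inv:
  fixes S :: "real ^ 'p ^ 'p"
  assumes "symmetric_posdef S"
  shows "symmetric_posdef (matrix_inv S)"
  unfolding symmetric_posdef_def
proof (intro conjI allI impI)
  let ?T = "matrix_inv S"
  have inv: "invertible S" and sym: "transpose S = S"
    using assms symmetric_posdef_invertible by (auto simp: symmetric_posdef_def)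
  have l: "?T ** S = mat 1" and r: "S ** ?T = mat 1"
    using inv by (auto simp: invertible_matrix_inv)
  have "transpose ?T ** S = mat 1"
    using r sym by (metis matrix_transpose_mul transpose_mat)
  then show "transpose ?T = ?T"
    by (metis matrix_mul_assoc matrix_mul_lid matrix_mul_rid r)
  fix v :: "real ^ 'p"
  assume "v \<noteq> 0"
  have v: "S *v (?T *v v) = v"
    by (simp add: matrix_vector_mul_assoc r)
  then have "?T *v v \<noteq> 0"
    using \<open>v \<noteq> 0\<close> by force
  then have "0 < (?T *v v) \<bullet> (S *v (?T *v v))"
    using assms by (simp add: symmetric_posdef_def)
  then show "0 < v \<bullet> (?T *v v)"
    by (simp add: v inner_commute)
qed

lemma symmetric_posdef_add:
  assumes "symmetric_posdef S" "symmetric_posdef T"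
  shows "symmetric_posdef (S + T)"
proof -
  have "transpose (S + T) = transpose S + transpose T"
    by (simp add: transpose_def vec_eq_iff)
  then show ?thesis
    using assms by (simp add: symmetric_posdef_def matrix_vector_mult_add_rdistrib inner_add_right add_pos_pos)
qed

section \<open>Gaussian densities and their products\<close>

lemma det_posdef_powr_pos:
  fixes S :: "real ^ 'p ^ 'p"
  assumes "symmetric_posdef S"
  shows "0 < det ((2 * pi) *\<^sub>R S) powr (- 1 / 2)"
proof -
  have "symmetric_posdef ((2 * pi) *\<^sub>R S)"
    using assms by (simp add: symmetric_posdef_def transpose_scalar flip: scaleR_matrix_vector_assoc)
  then have "invertible ((2 * pi) *\<^sub>R S)"
    by (rule symmetric_posdef_invertible)
  \<comment> \<open>\<open>powr\<close> at a nonzero base is an exponential, so a nonzero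
    determinant already gives positivity.\<close>
  then show ?thesis
    by (simp add: invertible_det_nz)
qed

lemma gaussian_density_pos:
  assumes "symmetric_posdef S"
  shows "0 < gaussian_density \<mu> S x"
  using det_posdef_powr_pos[OF assms] by (simp add: gaussian_density_def)

text \<open>Write both arguments as \<open>x - m\<close> plus a constant vector. The mixed terms add
  up to twice the inner product of \<open>x - m\<close> with
  \<open>P *v (m - \<mu>) + Q *v (m - \<nu>)\<close>, which is zero by the equation for
  \<open>m\<close>. What remains beside the form in \<open>x - m\<close> is free of
  \<open>x\<close>.\<close>

lemma complete_square:
  fixes P Q :: "real ^ 'p ^ 'p"
  assumes P: "symmetric_posdef P" and Q: "symmetric_posdef Q"
    and m: "(P + Q) *v m = P *v \<mu> + Q *v \<nu>"
  shows "(x - \<mu>) \<bullet> (P *v (x - \<mu>)) + (x - \<nu>) \<bullet> (Q *v (x - \<nu>))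
       = (x - m) \<bullet> ((P + Q) *v (x - m))
         + ((m - \<mu>) \<bullet> (P *v (m - \<mu>)) + (m - \<nu>) \<bullet> (Q *v (m - \<nu>)))"
proof -
  define h where "h = x - m"
  \<comment> \<open>Symmetry of \<open>A\<close> merges the two mixed terms, whence the factor
    2.\<close>
  have expand: "(h + u) \<bullet> (A *v (h + u)) = h \<bullet> (A *v h) + 2 * (h \<bullet> (A *v u)) + u \<bullet> (A *v u)"
    if "symmetric_posdef A" for A and u :: "real ^ 'p"
    using symmetric_posdef_inner_commute[OF that, of u h]
    by (simp add: matrix_vector_right_distrib inner_add_left inner_add_right)
  have "P *v (m - \<mu>) + Q *v (m - \<nu>) = 0"
    using m by (simp add: matrix_vector_mult_diff_distrib matrix_vector_mult_add_rdistrib algebra_simps)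
  then have cross: "h \<bullet> (P *v (m - \<mu>)) + h \<bullet> (Q *v (m - \<nu>)) = 0"
    by (metis inner_add_right inner_zero_right)
  have x: "x - \<mu> = h + (m - \<mu>)" "x - \<nu> = h + (m - \<nu>)" "x - m = h"
    by (simp_all add: h_def)
  show ?thesis
    unfolding x expand[OF P] expand[OF Q] matrix_vector_mult_add_rdistrib inner_add_right
    using cross by simp
qed

lemma gaussian_density_mult:
  fixes S T :: "real ^ 'p ^ 'p"
  assumes S: "symmetric_posdef S" and T: "symmetric_posdef T"
  obtains c m R where "0 < c" "symmetric_posdef R"
    "\<And>x. gaussian_density \<mu> S x * gaussian_density \<nu> T x = c * gaussian_density m R x"
proof -
  define P where "P = matrix_inv S"
  define Q where "Q = matrix_inv T"
  \<comment> \<open>Precisions add, so \<open>R\<close> is the covariance of the product, and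
    \<open>m\<close> is the precision-weighted mean of \<open>\<mu>\<close> and
    \<open>\<nu>\<close>.\<close>
  define R where "R = matrix_inv (P + Q)"
  define m where "m = R *v (P *v \<mu> + Q *v \<nu>)"
  define k where "k A = det ((2 * pi) *\<^sub>R A) powr (- 1 / 2)" for A :: "real ^ 'p ^ 'p"
  define d where "d = (m - \<mu>) \<bullet> (P *v (m - \<mu>)) + (m - \<nu>) \<bullet> (Q *v (m - \<nu>))"
  \<comment> \<open>\<open>c\<close> exchanges the normalising factors of \<open>S\<close> and
    \<open>T\<close> for that of \<open>R\<close> and absorbs the residue \<open>d\<close> of the
    completed square.\<close>
  define c where "c = k S * k T / k R * exp (- (1 / 2) * d)"
  have P: "symmetric_posdef P" and Q: "symmetric_posdef Q"
    using S T by (auto simp: P_def Q_def symmetric_posdef_matrix_inv)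
  have PQ: "symmetric_posdef (P + Q)"
    using P Q by (rule symmetric_posdef_add)
  then have inv: "(P + Q) ** R = mat 1" "R ** (P + Q) = mat 1"
    by (simp_all add: R_def invertible_matrix_inv symmetric_posdef_invertible)
  have R: "symmetric_posdef R"
    unfolding R_def using PQ by (rule symmetric_posdef_matrix_inv)
  have invR: "matrix_inv R = P + Q"
    using inv by (metis matrix_inv_unique)
  have k: "0 < k S" "0 < k T" "0 < k R"
    unfolding k_def using S T R by (simp_all only: det_posdef_powr_pos)
  have m: "(P + Q) *v m = P *v \<mu> + Q *v \<nu>"
    by (simp add: m_def matrix_vector_mul_assoc inv)
  have gd: "gaussian_density \<mu> A x = k A * exp (- (1 / 2) * ((x - \<mu>) \<bullet> (matrix_inv A *v (x - \<mu>))))"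
    for A \<mu> x
    by (simp add: gaussian_density_def k_def)
  show ?thesis
  proof
    show "0 < c"
      using k by (simp add: c_def)
    show "symmetric_posdef R" by (fact R)
    fix x
    have "gaussian_density \<mu> S x * gaussian_density \<nu> T x
        = k S * k T * exp (- (1 / 2) *
            ((x - \<mu>) \<bullet> (P *v (x - \<mu>)) + (x - \<nu>) \<bullet> (Q *v (x - \<nu>))))"
      unfolding gd P_def[symmetric] Q_def[symmetric] by (simp add: exp_add[symmetric] algebra_simps)
    also have "\<dots> = k S * k T * exp (- (1 / 2) * ((x - m) \<bullet> ((P + Q) *v (x - m)) + d))"
      unfolding complete_square[OF P Q m, of x] d_def ..
    also have "\<dots> = c * gaussian_density m R x"
      unfolding gd invR c_def distrib_left[of "- (1 / 2)"] exp_add using k by simp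
    finally show "gaussian_density \<mu> S x * gaussian_density \<nu> T x = c * gaussian_density m R x" .
  qed
qed

section \<open>Gated averages over finite index sets\<close>

text \<open>Membership from any finite index set and unnormalised positive weights, as they arise
  from pairs of components. Dividing the weights by their sum leaves the gates unchanged, and a
  bijection with \<open>{1..card I}\<close> supplies the numbering.\<close>

lemma gaussian_gated_classI:
  fixes m :: "real ^ 'p \<Rightarrow> real ^ 'q"
  assumes fin: "finite I" and ne: "I \<noteq> {}"
    and w: "\<And>i. i \<in> I \<Longrightarrow> 0 < w i"
    and S: "\<And>i. i \<in> I \<Longrightarrow> symmetric_posdef (S i)"
    and m: "\<And>x. x \<in> X \<Longrightarrow> m x =
      (\<Sum>i\<in>I. (w i * gaussian_density (\<mu> i) (S i) x /
        (\<Sum>j\<in>I. w j * gaussian_density (\<mu> j) (S j) x)) *\<^sub>R a i)"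
  shows "m \<in> gaussian_gated_class X"
proof -
  define W where "W = sum w I"
  have W: "0 < W"
    unfolding W_def using fin ne w by (rule sum_pos)
  obtain h where h: "bij_betw h {1..card I} I"
    using ex_bij_betw_nat_finite_1[OF fin] by blast
  then have hI: "h z \<in> I" if "z \<in> {1..card I}" for z
    using that by (meson bij_betwE)
  \<comment> \<open>Kept polymorphic, since it serves both the real denominators and the
    vector-valued sum.\<close>
  have reindex: "(\<Sum>z=1..card I. f (h z)) = sum f I" for f :: "'a \<Rightarrow> 'b::comm_monoid_add"
    using h by (rule sum.reindex_bij_betw)
  show ?thesis
    unfolding gaussian_gated_class_def mem_Collect_eq
  proof (intro exI conjI ballI)
    show "1 \<le> card I"
      using fin ne by (simp add: Suc_le_eq card_gt_0_iff)
    show "0 < w (h z) / W" if "z \<in> {1..card I}" for z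
      using W w[OF hI[OF that]] by simp
    show "(\<Sum>z=1..card I. w (h z) / W) = 1"
      using W by (simp only: sum_divide_distrib[symmetric] reindex W_def) simp
    show "symmetric_posdef (S (h z))" if "z \<in> {1..card I}" for z
      using S[OF hI[OF that]] .
    fix x assume x: "x \<in> X"
    let ?g = "\<lambda>i. gaussian_density (\<mu> i) (S i) x"
    have D: "(\<Sum>j\<in>I. w j / W * ?g j) = (\<Sum>j\<in>I. w j * ?g j) / W"
      by (simp add: sum_divide_distrib)
    have "m x = (\<Sum>i\<in>I. (w i / W * ?g i / (\<Sum>j\<in>I. w j / W * ?g j)) *\<^sub>R a i)"
      unfolding m[OF x] D using W by simp
    also have "\<dots> = (\<Sum>z=1..card I. (w (h z) / W * ?g (h z) /
        (\<Sum>\<zeta>=1..card I. w (h \<zeta>) / W * ?g (h \<zeta>))) *\<^sub>R a (h z))"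
      unfolding reindex[of "\<lambda>j. w j / W * ?g j"]
      by (rule reindex[symmetric])
    finally show "m x = (\<Sum>z=1..card I. (w (h z) / W * gaussian_density (\<mu> (h z)) (S (h z)) x /
        (\<Sum>\<zeta>=1..card I. w (h \<zeta>) / W * gaussian_density (\<mu> (h \<zeta>)) (S (h \<zeta>)) x)) *\<^sub>R a (h z))" .
  qed
qed

text \<open>The gates of each family sum to one, so either average may be multiplied by the total of
  the other family's gates.\<close>

lemma sum_gated_averages:
  fixes u :: "'i \<Rightarrow> real" and v :: "'j \<Rightarrow> real" and a b :: "_ \<Rightarrow> 'v::real_vector"
  assumes u: "sum u I \<noteq> 0" and v: "sum v J \<noteq> 0"
  shows "(\<Sum>i\<in>I. (u i / sum u I) *\<^sub>R a i) + (\<Sum>j\<in>J. (v j / sum v J) *\<^sub>R b j)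
    = (\<Sum>(i, j)\<in>I \<times> J. (u i * v j / (\<Sum>(i, j)\<in>I \<times> J. u i * v j)) *\<^sub>R (a i + b j))"
proof -
  define p where "p i = u i / sum u I" for i
  define q where "q j = v j / sum v J" for j
  have p: "sum p I = 1" and q: "sum q J = 1"
    using u v by (simp_all add: p_def q_def sum_divide_distrib[symmetric])
  \<comment> \<open>The denominator factors, so the gate of a pair splits as
    \<open>p i * q j\<close>.\<close>
  have "(\<Sum>(i, j)\<in>I \<times> J. u i * v j) = sum u I * sum v J"
    by (simp add: sum_product sum.cartesian_product)
  then have "(\<Sum>(i, j)\<in>I \<times> J. (u i * v j / (\<Sum>(i, j)\<in>I \<times> J. u i * v j)) *\<^sub>R (a i + b j))
      = (\<Sum>i\<in>I. \<Sum>j\<in>J. (p i * q j) *\<^sub>R (a i + b j))"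
    by (simp add: sum.cartesian_product p_def q_def)
  \<comment> \<open>The second double sum is swapped so that each inner sum runs over the index on
    which its vector does not depend.\<close>
  also have "\<dots> = (\<Sum>i\<in>I. \<Sum>j\<in>J. (p i * q j) *\<^sub>R a i) + (\<Sum>j\<in>J. \<Sum>i\<in>I. (p i * q j) *\<^sub>R b j)"
    by (simp add: scaleR_add_right sum.distrib sum.swap[of _ J I])
  also have "\<dots> = (\<Sum>i\<in>I. (p i * sum q J) *\<^sub>R a i) + (\<Sum>j\<in>J. (sum p I * q j) *\<^sub>R b j)"
    by (simp only: scaleR_sum_left[symmetric] sum_distrib_left[symmetric] sum_distrib_right[symmetric])
  finally show ?thesis
    by (simp add: p q) (simp add: p_def q_def)
qed

lemma gated_averages_add_in_class:
  fixes X :: "(real ^ 'p) set" and m1 m2 :: "real ^ 'p \<Rightarrow> real ^ 'q"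
  assumes I: "finite I" "I \<noteq> {}" and J: "finite J" "J \<noteq> {}"
    and \<pi>1: "\<forall>i\<in>I. 0 < \<pi>1 i" and \<pi>2: "\<forall>j\<in>J. 0 < \<pi>2 j"
    and S1: "\<forall>i\<in>I. symmetric_posdef (S1 i)" and S2: "\<forall>j\<in>J. symmetric_posdef (S2 j)"
    and m1: "\<forall>x\<in>X. m1 x = (\<Sum>i\<in>I. (\<pi>1 i * gaussian_density (\<mu>1 i) (S1 i) x /
        (\<Sum>k\<in>I. \<pi>1 k * gaussian_density (\<mu>1 k) (S1 k) x)) *\<^sub>R a1 i)"
    and m2: "\<forall>x\<in>X. m2 x = (\<Sum>j\<in>J. (\<pi>2 j * gaussian_density (\<mu>2 j) (S2 j) x /
        (\<Sum>k\<in>J. \<pi>2 k * gaussian_density (\<mu>2 k) (S2 k) x)) *\<^sub>R a2 j)"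
  shows "(\<lambda>x. m1 x + m2 x) \<in> gaussian_gated_class X"
proof -
  let ?K = "I \<times> J"
  have "\<exists>c m R. 0 < c \<and> symmetric_posdef R \<and>
      (\<forall>x. gaussian_density (\<mu>1 i) (S1 i) x * gaussian_density (\<mu>2 j) (S2 j) x
         = c * gaussian_density m R x)" if "i \<in> I" "j \<in> J" for i j
    using gaussian_density_mult[of "S1 i" "S2 j" "\<mu>1 i" "\<mu>2 j"] S1 S2 that by metis
  \<comment> \<open>The constants, means and covariances are chosen as functions of the
    pair.\<close>
  then obtain c m R where c: "\<And>i j. (i, j) \<in> ?K \<Longrightarrow> 0 < c i j"
    and R: "\<And>i j. (i, j) \<in> ?K \<Longrightarrow> symmetric_posdef (R i j)"
    and prod: "\<And>i j x. (i, j) \<in> ?K \<Longrightarrow>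
      gaussian_density (\<mu>1 i) (S1 i) x * gaussian_density (\<mu>2 j) (S2 j) x
      = c i j * gaussian_density (m i j) (R i j) x"
    unfolding mem_Sigma_iff by metis
  show ?thesis
  \<comment> \<open>The factor \<open>c i j\<close> in the weight is the constant left over when two
    component densities are multiplied into one.\<close>
  proof (rule gaussian_gated_classI[where I = ?K and w = "\<lambda>(i, j). \<pi>1 i * \<pi>2 j * c i j"
        and S = "\<lambda>(i, j). R i j" and \<mu> = "\<lambda>(i, j). m i j" and a = "\<lambda>(i, j). a1 i + a2 j"])
    show "finite ?K" "?K \<noteq> {}"
      using I J by auto
    show "0 < (case z of (i, j) \<Rightarrow> \<pi>1 i * \<pi>2 j * c i j)"
      and "symmetric_posdef (case z of (i, j) \<Rightarrow> R i j)" if "z \<in> ?K" for z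
      using that c R \<pi>1 \<pi>2 by auto
    fix x assume x: "x \<in> X"
    define u where "u i = \<pi>1 i * gaussian_density (\<mu>1 i) (S1 i) x" for i
    define v where "v j = \<pi>2 j * gaussian_density (\<mu>2 j) (S2 j) x" for j
    \<comment> \<open>\<open>g\<close> is the gate numerator in the shape the introduction rule
      demands; it agrees with \<open>u i * v j\<close> on \<open>?K\<close>, which is all that the
      sums see.\<close>
    define g where "g z = (case z of (i, j) \<Rightarrow> \<pi>1 i * \<pi>2 j * c i j) *
      gaussian_density (case z of (i, j) \<Rightarrow> m i j) (case z of (i, j) \<Rightarrow> R i j) x" for z
    have g: "g (i, j) = u i * v j" if "(i, j) \<in> ?K" for i j
      using prod[OF that, of x] by (simp add: g_def u_def v_def mult.assoc mult.left_commute)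
    have "0 < sum u I" "0 < sum v J"
      using I J \<pi>1 \<pi>2 S1 S2 by (auto intro!: sum_pos simp: u_def v_def gaussian_density_pos)
    then have "m1 x + m2 x
        = (\<Sum>(i, j)\<in>?K. (u i * v j / (\<Sum>(i, j)\<in>?K. u i * v j)) *\<^sub>R (a1 i + a2 j))"
      using m1 m2 x sum_gated_averages[of u "I" v "J" a1 a2] by (simp add: u_def v_def)
    also have "(\<Sum>(i, j)\<in>?K. u i * v j) = sum g ?K"
      using g by (intro sum.cong) auto
    also have "(\<Sum>(i, j)\<in>?K. (u i * v j / sum g ?K) *\<^sub>R (a1 i + a2 j))
        = (\<Sum>z\<in>?K. (g z / sum g ?K) *\<^sub>R (case z of (i, j) \<Rightarrow> a1 i + a2 j))"
      using g by (intro sum.cong) auto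
    finally show "m1 x + m2 x = (\<Sum>z\<in>?K. ((case z of (i, j) \<Rightarrow> \<pi>1 i * \<pi>2 j * c i j) *
        gaussian_density (case z of (i, j) \<Rightarrow> m i j) (case z of (i, j) \<Rightarrow> R i j) x /
        (\<Sum>z\<in>?K. (case z of (i, j) \<Rightarrow> \<pi>1 i * \<pi>2 j * c i j) *
        gaussian_density (case z of (i, j) \<Rightarrow> m i j) (case z of (i, j) \<Rightarrow> R i j) x)) *\<^sub>R
        (case z of (i, j) \<Rightarrow> a1 i + a2 j))"
      unfolding g_def .
  qed
qed

theorem lemma2:
  fixes X :: "(real ^ 'p) set"
    and m1 m2 :: "real ^ 'p \<Rightarrow> real ^ 'q"
  assumes "m1 \<in> gaussian_gated_class X"
    and "m2 \<in> gaussian_gated_class X"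
  shows "(\<lambda>x. m1 x + m2 x) \<in> gaussian_gated_class X"
proof -
  obtain n1 :: nat and \<pi>1 \<mu>1 S1 and a1 :: "nat \<Rightarrow> real ^ 'q"
    where n1: "1 \<le> n1" and \<pi>1: "\<forall>z\<in>{1..n1}. 0 < \<pi>1 z"
      and S1: "\<forall>z\<in>{1..n1}. symmetric_posdef (S1 z)"
      and m1: "\<forall>x\<in>X. m1 x = (\<Sum>z=1..n1. (\<pi>1 z * gaussian_density (\<mu>1 z) (S1 z) x /
        (\<Sum>\<zeta>=1..n1. \<pi>1 \<zeta> * gaussian_density (\<mu>1 \<zeta>) (S1 \<zeta>) x)) *\<^sub>R a1 z)"
    using assms(1) unfolding gaussian_gated_class_def by blast
  obtain n2 :: nat and \<pi>2 \<mu>2 S2 and a2 :: "nat \<Rightarrow> real ^ 'q"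
    where n2: "1 \<le> n2" and \<pi>2: "\<forall>z\<in>{1..n2}. 0 < \<pi>2 z"
      and S2: "\<forall>z\<in>{1..n2}. symmetric_posdef (S2 z)"
      and m2: "\<forall>x\<in>X. m2 x = (\<Sum>z=1..n2. (\<pi>2 z * gaussian_density (\<mu>2 z) (S2 z) x /
        (\<Sum>\<zeta>=1..n2. \<pi>2 \<zeta> * gaussian_density (\<mu>2 \<zeta>) (S2 \<zeta>) x)) *\<^sub>R a2 z)"
    using assms(2) unfolding gaussian_gated_class_def by blast
  \<comment> \<open>The bounds on \<open>n1\<close> and \<open>n2\<close> make both index ranges
    nonempty.\<close>
  show ?thesis
    using n1 n2 by (intro gated_averages_add_in_class[OF _ _ _ _ \<pi>1 \<pi>2 S1 S2 m1 m2]) auto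
qed

end
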